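(* Let $\mathbf{H}$ be one of $\mathbf{Z}$, $\mathbf{N}$, $\mathbf{N}^+$. Given $K \in [1,\infty]$, there exists a non-monotone, subadditive, $(-1)$-homogeneous, and translational invariant function $\theta^\star: \mathcal{P}(\mathbf{H}) \to \mathbf{R}$ with the property that $\sup_{X \in \mathcal{P}(\mathbf{H})} \theta^\star(X) = K$. In particular, there exists an upper quasi-density on $\mathbf{H}$ that is not an upper density on $\mathbf{H}$.
   Context: $\mathbf{N}$ is the set of non-negative integers (so $0\in\mathbf N$), $\mathbf{N}^+$ the set of positive integers, $\mathcal{P}(\mathbf{H})$ the power set of $\mathbf{H}$. For $X\subseteq \mathbf{H}$ and integers $k,h$, $k\cdot X+h:=\{kx+h: x\in X\}$, $k\cdot X := k\cdot X+0$, $X+h:=1\cdot X+h$. For a function $\mu^\star: \mathcal{P}(\mathbf{H}) \to \mathbf{R}$ consider: (F1) $\mu^\star(\mathbf{H})=1$; (F2) $\mu^\star(X)\le\mu^\star(Y)$ for all $X\subseteq Y\subseteq\mathbf{H}$; (F3) $\mu^\star(X\cup Y)\le\mu^\star(X)+\mu^\star(Y)$ for all $X,Y\subseteq\mathbf{H}$; (F4) $\mu^\star(k\cdot X)=\frac1k\mu^\star(X)$ for all $X\subseteq\mathbf{H}$, $k\in\mathbf{N}^+$; (F5) $\mu^\star(X+h)=\mu^\star(X)$ for all $X\subseteq\mathbf{H}$, $h\in\mathbf{N}$. $\mu^\star$ is called monotone if it satisfies (F2), subadditive if (F3), $(-1)$-homogeneous if (F4), translational invariant if (F5). It is an upper density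 on $\mathbf{H}$ if it satisfies (F1)–(F5), and an upper quasi-density on $\mathbf{H}$ if $\mu^\star(X)\le 1$ for every $X\subseteq\mathbf{H}$ and it satisfies (F1), (F3), (F4), (F5). *)

theory Defs
  imports "HOL-Library.Extended_Real"
begin

text \<open>
  A function \<open>\<P>(H) \<rightarrow> \<real>\<close> with \<open>H \<subseteq> \<int>\<close> is represented by a total function
  of type \<open>int set \<Rightarrow> real\<close> of which only the values on \<open>Pow H\<close> are ever mentioned.
  Monotonicity (F2) is the library notion \<open>mono_on (Pow H)\<close>: the order on
  \<open>int set\<close> is inclusion.
\<close>

definition affine_image :: "int \<Rightarrow> int \<Rightarrow> int set \<Rightarrow> int set" where
  "affine_image k h X = (\<lambda>x. k * x + h) ` X"

definition subadditive_on :: "int set \<Rightarrow> (int set \<Rightarrow> real) \<Rightarrow> bool" where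
  "subadditive_on H \<mu> \<longleftrightarrow>
     (\<forall>X Y. X \<subseteq> H \<longrightarrow> Y \<subseteq> H \<longrightarrow> \<mu> (X \<union> Y) \<le> \<mu> X + \<mu> Y)"

definition neg_one_homogeneous_on :: "int set \<Rightarrow> (int set \<Rightarrow> real) \<Rightarrow> bool" where
  "neg_one_homogeneous_on H \<mu> \<longleftrightarrow>
     (\<forall>X (k::nat). X \<subseteq> H \<longrightarrow> 1 \<le> k \<longrightarrow> \<mu> (affine_image (int k) 0 X) = 1 / real k * \<mu> X)"

text \<open>Shifts are by natural numbers only, also for \<open>H = UNIV\<close>.\<close>

definition translation_invariant_on :: "int set \<Rightarrow> (int set \<Rightarrow> real) \<Rightarrow> bool" where
  "translation_invariant_on H \<mu> \<longleftrightarrow>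
     (\<forall>X (h::nat). X \<subseteq> H \<longrightarrow> \<mu> (affine_image 1 (int h) X) = \<mu> X)"

definition upper_density :: "int set \<Rightarrow> (int set \<Rightarrow> real) \<Rightarrow> bool" where
  "upper_density H \<mu> \<longleftrightarrow>
     \<mu> H = 1 \<and> mono_on (Pow H) \<mu> \<and> subadditive_on H \<mu> \<and>
     neg_one_homogeneous_on H \<mu> \<and> translation_invariant_on H \<mu>"

definition upper_quasi_density :: "int set \<Rightarrow> (int set \<Rightarrow> real) \<Rightarrow> bool" where
  "upper_quasi_density H \<mu> \<longleftrightarrow>
     (\<forall>X. X \<subseteq> H \<longrightarrow> \<mu> X \<le> 1) \<and> \<mu> H = 1 \<and> subadditive_on H \<mu> \<and>
     neg_one_homogeneous_on H \<mu> \<and> translation_invariant_on H \<mu>"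

end

theory Submission
  imports Defs "HOL-Library.Nat_Bijection"
begin

text \<open>
  Multiply a function \<open>\<mu>\<close> satisfying (F3)--(F5) by a weight \<open>w \<ge> 0\<close> that is unchanged under
  dilations and translations and does not increase when the set grows. The product still satisfies
  (F3)--(F5), because \<open>w (X \<union> Y)\<close> is at most both \<open>w X\<close> and \<open>w Y\<close>; but a small set of large
  weight may now beat a larger set, which destroys monotonicity (\<open>weighted_density\<close>).

  The functions \<open>\<mu>\<close> are Buck densities modulo an ideal \<open>Z\<close> of negligible sets: the infimum over
  \<open>m\<close> of the proportion of residue classes modulo \<open>m\<close> that meet \<open>X\<close> in a non-negligible set. If
  \<open>Z\<close> is invariant under dilations and translations, (F3)--(F5) follow by counting residue classes,
  and the members of \<open>Z\<close> get density 0.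

  A set may be very sparse and still have Buck density 1 modulo an ideal, since it only has to meet
  every residue class in a non-negligible set. Hence there are positive sets \<open>B\<^sub>0, B\<^sub>1, \<dots>\<close>
  (\<open>spikes\<close>), each meeting every residue class in an infinite set, and spread so thinly that the
  affine images of any two of them have finite intersection (\<open>spikes_almost_disjoint\<close>). Let \<open>Z\<^sub>n\<close> be
  the ideal of the sets almost disjoint from all affine images of \<open>B\<^sub>n\<close>, and \<open>Z\<close> the intersection
  of all \<open>Z\<^sub>n\<close>. Then \<open>B\<^sub>n\<close> lies in \<open>Z\<^sub>m\<close> for all \<open>m \<noteq> n\<close>, yet has density 1 modulo \<open>Z\<^sub>n\<close> and modulo
  \<open>Z\<close>.

  For \<open>K = \<infinity>\<close> take the density modulo \<open>Z\<close> with weight \<open>1 + min {n. X \<notin> Z\<^sub>n}\<close>. The minimum exists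
  unless \<open>X \<in> Z\<close>, and then the density is 0 anyway. The value at \<open>B\<^sub>n\<close> is \<open>1 + n\<close>, while the whole of
  \<open>H\<close> has value 1.

  For the quasi-density take the mean of the densities modulo \<open>Z\<close> and modulo \<open>Z\<^sub>0\<close>, with weight 2 on
  \<open>Z\<^sub>0\<close> and weight 1 elsewhere. The doubling is harmless for the bound 1, since on \<open>Z\<^sub>0\<close> the second
  summand vanishes. But \<open>B\<^sub>1\<close> has value 1, and adding \<open>2 \<cdot> B\<^sub>0\<close> to it, which is half as dense as \<open>B\<^sub>0\<close>
  modulo \<open>Z\<^sub>0\<close>, lowers the value to at most 3/4. Multiples of this quasi-density settle all finite
  \<open>K\<close>.

  All of these functions satisfy (F3)--(F5) on all sets of integers, so they can be restricted to the
  subsets of \<open>H\<close>; and \<open>H\<close> contains the positive integers, hence every \<open>B\<^sub>n\<close>.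
\<close>

section \<open>Buck density modulo an ideal\<close>

locale affine_ideal =
  fixes Z :: "int set set"
  assumes empty_mem: "{} \<in> Z"
    and subset_mem: "\<And>X Y. Y \<in> Z \<Longrightarrow> X \<subseteq> Y \<Longrightarrow> X \<in> Z"
    and union_mem: "\<And>X Y. X \<in> Z \<Longrightarrow> Y \<in> Z \<Longrightarrow> X \<union> Y \<in> Z"
    and dilation_mem_iff: "\<And>X (k::nat). 1 \<le> k \<Longrightarrow> affine_image (int k) 0 X \<in> Z \<longleftrightarrow> X \<in> Z"
    and translation_mem_iff: "\<And>X (h::nat). affine_image 1 (int h) X \<in> Z \<longleftrightarrow> X \<in> Z"

lemma affine_ideal_Inter:
  assumes "\<And>n. affine_ideal (Z n)"
  shows "affine_ideal (\<Inter>n. Z n)"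
proof -
  interpret affine_ideal "Z n" for n by (rule assms)
  show ?thesis
    by unfold_locales (auto simp: empty_mem union_mem dilation_mem_iff translation_mem_iff
        intro: subset_mem)
qed

definition occupied_classes :: "int set set \<Rightarrow> nat \<Rightarrow> int set \<Rightarrow> int set" where
  "occupied_classes Z m X = {r \<in> {0..<int m}. {x \<in> X. x mod int m = r} \<notin> Z}"

definition buck_density :: "int set set \<Rightarrow> int set \<Rightarrow> real" where
  "buck_density Z X = (INF m\<in>{1..}. real (card (occupied_classes Z m X)) / real m)"

lemma finite_occupied_classes [simp]: "finite (occupied_classes Z m X)"
  unfolding occupied_classes_def by (rule finite_subset[of _ "{0..<int m}"]) auto

lemma card_occupied_classes_le: "card (occupied_classes Z m X) \<le> m"
proof -
  have "card (occupied_classes Z m X) \<le> card {0..<int m}"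
    unfolding occupied_classes_def by (intro card_mono) auto
  then show ?thesis by simp
qed

lemma buck_density_le:
  assumes "1 \<le> m"
  shows "buck_density Z X \<le> real (card (occupied_classes Z m X)) / real m"
  unfolding buck_density_def using assms
  by (intro cINF_lower bdd_belowI[of _ 0]) auto

lemma buck_density_greatest:
  assumes "\<And>m. 1 \<le> m \<Longrightarrow> c \<le> real (card (occupied_classes Z m X)) / real m"
  shows "c \<le> buck_density Z X"
  unfolding buck_density_def using assms by (intro cINF_greatest) auto

lemma buck_density_nonneg: "0 \<le> buck_density Z X"
  by (rule buck_density_greatest) simp

lemma buck_density_le_1: "buck_density Z X \<le> 1"
  using buck_density_le[of 1 Z X] card_occupied_classes_le[of Z 1 X] by simp

lemma buck_density_eq_1:
  assumes "\<And>m r. 0 \<le> r \<Longrightarrow> r < int m \<Longrightarrow> {x \<in> X. x mod int m = r} \<notin> Z"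
  shows "buck_density Z X = 1"
proof -
  have "occupied_classes Z m X = {0..<int m}" for m
    using assms unfolding occupied_classes_def by auto
  then have "1 \<le> buck_density Z X"
    by (intro buck_density_greatest) simp
  then show ?thesis using buck_density_le_1[of Z X] by simp
qed

context affine_ideal
begin

lemma buck_density_eq_0:
  assumes "X \<in> Z"
  shows "buck_density Z X = 0"
proof -
  have "occupied_classes Z 1 X = {}"
    unfolding occupied_classes_def using subset_mem[OF assms] by auto
  then show ?thesis
    using buck_density_le[of 1 Z X] buck_density_nonneg[of Z X] by simp
qed

text \<open>
  Each residue class modulo \<open>m\<close> splits into \<open>k\<close> classes modulo \<open>m * k\<close>, and a class with an occupied
  part is itself occupied. So passing to a multiple of the modulus never increases the proportion,
  which lets the later proofs bring two moduli to a common one.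
\<close>

lemma card_occupied_classes_refine:
  assumes "1 \<le> m" "1 \<le> k"
  shows "card (occupied_classes Z (m * k) X) \<le> card (occupied_classes Z m X) * k"
proof -
  \<comment> \<open>A class modulo \<open>m * k\<close> is coded by the class modulo \<open>m\<close> above it and its position inside.\<close>
  let ?f = "\<lambda>s. (s mod int m, s div int m)"
  have inj: "inj_on ?f A" for A
    by (rule inj_onI) (metis Pair_inject mult_div_mod_eq)
  have "?f ` occupied_classes Z (m * k) X \<subseteq> occupied_classes Z m X \<times> {0..<int k}"
  proof
    fix p assume "p \<in> ?f ` occupied_classes Z (m * k) X"
    then obtain s where p: "p = ?f s" and s: "0 \<le> s" "s < int m * int k"
      and occ: "{x \<in> X. x mod (int m * int k) = s} \<notin> Z"
      unfolding occupied_classes_def by auto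
    have "{x \<in> X. x mod (int m * int k) = s} \<subseteq> {x \<in> X. x mod int m = s mod int m}"
      by (auto simp: mod_mod_cancel)
    with occ have "{x \<in> X. x mod int m = s mod int m} \<notin> Z"
      using subset_mem by blast
    moreover have "s div int m < int k"
    proof (rule ccontr)
      assume "\<not> s div int m < int k"
      then have "int m * int k \<le> int m * (s div int m)" by (intro mult_left_mono) auto
      also have "\<dots> \<le> s" using assms by (simp add: minus_mod_eq_mult_div [symmetric])
      finally show False using s by simp
    qed
    ultimately show "p \<in> occupied_classes Z m X \<times> {0..<int k}"
      using p s assms unfolding occupied_classes_def by (auto simp: pos_imp_zdiv_nonneg_iff)
  qed
  then have "card (?f ` occupied_classes Z (m * k) X) \<le> card (occupied_classes Z m X \<times> {0..<int k})"
    by (intro card_mono) auto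
  then show ?thesis
    by (simp add: card_image[OF inj] card_cartesian_product)
qed

lemma occupied_ratio_refine:
  assumes "1 \<le> m" "1 \<le> k"
  shows "real (card (occupied_classes Z (m * k) X)) / real (m * k)
           \<le> real (card (occupied_classes Z m X)) / real m"
proof -
  have "real (card (occupied_classes Z (m * k) X)) \<le> real (card (occupied_classes Z m X)) * real k"
    using card_occupied_classes_refine[OF assms, of X] by (metis of_nat_le_iff of_nat_mult)
  then show ?thesis using assms by (simp add: field_simps)
qed

lemma card_occupied_classes_Un:
  "card (occupied_classes Z m (X \<union> Y))
     \<le> card (occupied_classes Z m X) + card (occupied_classes Z m Y)"
proof -
  have "{x \<in> X \<union> Y. P x} = {x \<in> X. P x} \<union> {x \<in> Y. P x}" for P by auto
  then have "occupied_classes Z m (X \<union> Y) \<subseteq> occupied_classes Z m X \<union> occupied_classes Z m Y"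
    unfolding occupied_classes_def by (auto intro: union_mem)
  then have "card (occupied_classes Z m (X \<union> Y))
      \<le> card (occupied_classes Z m X \<union> occupied_classes Z m Y)"
    by (intro card_mono) auto
  then show ?thesis using card_Un_le order_trans by blast
qed

lemma subadditive_buck_density: "subadditive_on UNIV (buck_density Z)"
  unfolding subadditive_on_def
proof (intro allI impI)
  fix X Y
  have *: "buck_density Z (X \<union> Y)
      \<le> real (card (occupied_classes Z m X)) / real m + real (card (occupied_classes Z n Y)) / real n"
    if mn: "1 \<le> m" "1 \<le> n" for m n
  proof -
    have "buck_density Z (X \<union> Y) \<le> real (card (occupied_classes Z (m * n) (X \<union> Y))) / real (m * n)"
      using mn by (intro buck_density_le) simp
    also have "\<dots> \<le> real (card (occupied_classes Z (m * n) X)) / real (m * n)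
                 + real (card (occupied_classes Z (n * m) Y)) / real (n * m)"
      using card_occupied_classes_Un[of "m * n" X Y]
      by (simp add: mult.commute flip: add_divide_distrib of_nat_add) (intro divide_right_mono, auto)
    also have "\<dots> \<le> real (card (occupied_classes Z m X)) / real m
                 + real (card (occupied_classes Z n Y)) / real n"
      using mn by (intro add_mono occupied_ratio_refine)
    finally show ?thesis .
  qed
  \<comment> \<open>Take the infimum over \<open>n\<close> first, then over \<open>m\<close>.\<close>
  have "buck_density Z (X \<union> Y) - real (card (occupied_classes Z m X)) / real m
      \<le> buck_density Z Y" if "1 \<le> m" for m
    using *[OF that] by (intro buck_density_greatest) (simp add: algebra_simps)
  then have "buck_density Z (X \<union> Y) - buck_density Z Y \<le> buck_density Z X"
    by (intro buck_density_greatest) (simp add: algebra_simps)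
  then show "buck_density Z (X \<union> Y) \<le> buck_density Z X + buck_density Z Y" by simp
qed

text \<open>
  All elements of \<open>k \<cdot> X\<close> are divisible by \<open>k\<close>, so the only candidates modulo \<open>m * k\<close> are the
  classes of \<open>k * r\<close>, and such a class cuts out of \<open>k \<cdot> X\<close> the dilation of what the class of \<open>r\<close>
  modulo \<open>m\<close> cuts out of \<open>X\<close>.
\<close>

lemma card_occupied_classes_dilation:
  assumes "1 \<le> k"
  shows "card (occupied_classes Z (m * k) (affine_image (int k) 0 X)) = card (occupied_classes Z m X)"
proof -
  let ?kX = "affine_image (int k) 0 X"
  have cls: "{y \<in> ?kX. y mod int (m * k) = int k * r} = affine_image (int k) 0 {x \<in> X. x mod int m = r}"
    for r
    using assms unfolding affine_image_def by (auto simp: mult.commute[of "int m"])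
  have "occupied_classes Z (m * k) ?kX = (\<lambda>r. int k * r) ` occupied_classes Z m X"
  proof (intro equalityI subsetI)
    fix s assume s: "s \<in> occupied_classes Z (m * k) ?kX"
    then have "{y \<in> ?kX. y mod int (m * k) = s} \<notin> Z"
      unfolding occupied_classes_def by blast
    then have "{y \<in> ?kX. y mod int (m * k) = s} \<noteq> {}"
      using empty_mem by metis
    then obtain x where "s = (int k * x) mod int (m * k)"
      unfolding affine_image_def by auto
    then have sx: "s = int k * (x mod int m)"
      by (simp add: mult.commute[of "int m"])
    have m: "0 < int m"
      using s unfolding occupied_classes_def by (cases m) auto
    have "{y \<in> ?kX. y mod int (m * k) = int k * (x mod int m)} \<notin> Z"
      using s sx unfolding occupied_classes_def by simp
    then have "x mod int m \<in> occupied_classes Z m X"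
      using m unfolding cls dilation_mem_iff[OF assms] occupied_classes_def by simp
    with sx show "s \<in> (\<lambda>r. int k * r) ` occupied_classes Z m X" by blast
  next
    fix s assume "s \<in> (\<lambda>r. int k * r) ` occupied_classes Z m X"
    then obtain r where r: "r \<in> occupied_classes Z m X" and s: "s = int k * r" by blast
    have "{y \<in> ?kX. y mod int (m * k) = int k * r} \<notin> Z"
      using r unfolding cls dilation_mem_iff[OF assms] occupied_classes_def by simp
    moreover have "int k * r < int (m * k)"
      using r assms unfolding occupied_classes_def by (simp add: mult.commute)
    ultimately show "s \<in> occupied_classes Z (m * k) ?kX"
      using r s unfolding occupied_classes_def by simp
  qed
  moreover have "inj_on (\<lambda>r. int k * r) (occupied_classes Z m X)"
    using assms by (intro inj_onI) simp
  ultimately show ?thesis by (simp add: card_image)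
qed

text \<open>
  Moduli that are multiples of \<open>k\<close> give one inequality at once. For the other, an arbitrary modulus
  for \<open>k \<cdot> X\<close> is first refined to a multiple of \<open>k\<close>.
\<close>

lemma homogeneous_buck_density: "neg_one_homogeneous_on UNIV (buck_density Z)"
  unfolding neg_one_homogeneous_on_def
proof (intro allI impI)
  fix X and k :: nat assume k: "1 \<le> k"
  let ?kX = "affine_image (int k) 0 X"
  have "real k * buck_density Z ?kX \<le> buck_density Z X"
  proof (rule buck_density_greatest)
    fix m :: nat assume m: "1 \<le> m"
    have "buck_density Z ?kX \<le> real (card (occupied_classes Z m X)) / real (m * k)"
      using buck_density_le[of "m * k" Z ?kX] m k by (simp add: card_occupied_classes_dilation)
    then show "real k * buck_density Z ?kX \<le> real (card (occupied_classes Z m X)) / real m"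
      using m k by (simp add: field_simps)
  qed
  moreover have "1 / real k * buck_density Z X \<le> buck_density Z ?kX"
  proof (rule buck_density_greatest)
    fix m :: nat assume m: "1 \<le> m"
    have "1 / real k * buck_density Z X \<le> 1 / real k * (real (card (occupied_classes Z m X)) / real m)"
      using buck_density_le[OF m] by (intro mult_left_mono) auto
    also have "\<dots> = real (card (occupied_classes Z (m * k) ?kX)) / real (m * k)"
      by (simp only: card_occupied_classes_dilation[OF k]) simp
    also have "\<dots> \<le> real (card (occupied_classes Z m ?kX)) / real m"
      by (rule occupied_ratio_refine[OF m k])
    finally show "1 / real k * buck_density Z X \<le> real (card (occupied_classes Z m ?kX)) / real m" .
  qed
  ultimately show "buck_density Z ?kX = 1 / real k * buck_density Z X"
    using k by (simp add: field_simps)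
qed

lemma card_occupied_classes_translation:
  "card (occupied_classes Z m (affine_image 1 (int h) X)) = card (occupied_classes Z m X)"
proof -
  let ?Y = "affine_image 1 (int h) X" and ?f = "\<lambda>r. (r + int h) mod int m"
  have shift: "(x + int h) mod int m = (r + int h) mod int m \<longleftrightarrow> x mod int m = r mod int m" for x r
    by (simp add: mod_eq_dvd_iff)
  have cls: "{y \<in> ?Y. y mod int m = ?f r} = affine_image 1 (int h) {x \<in> X. x mod int m = r}"
    if "0 \<le> r" "r < int m" for r
    using that shift[of _ r] unfolding affine_image_def by auto
  have "occupied_classes Z m ?Y = ?f ` occupied_classes Z m X"
  proof (intro equalityI subsetI)
    fix s assume s: "s \<in> occupied_classes Z m ?Y"
    then have sm: "0 \<le> s" "s < int m" unfolding occupied_classes_def by auto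
    define r where "r = (s - int h) mod int m"
    have r: "0 \<le> r" "r < int m" using sm unfolding r_def by auto
    have sr: "s = ?f r" using sm unfolding r_def by (simp add: mod_add_left_eq)
    have "{y \<in> ?Y. y mod int m = ?f r} \<notin> Z"
      using s sr unfolding occupied_classes_def by simp
    then have "r \<in> occupied_classes Z m X"
      using r unfolding cls[OF r] translation_mem_iff occupied_classes_def by simp
    with sr show "s \<in> ?f ` occupied_classes Z m X" by blast
  next
    fix s assume "s \<in> ?f ` occupied_classes Z m X"
    then obtain r where r: "0 \<le> r" "r < int m" "{x \<in> X. x mod int m = r} \<notin> Z" and s: "s = ?f r"
      unfolding occupied_classes_def by auto
    then have "{y \<in> ?Y. y mod int m = ?f r} \<notin> Z"
      unfolding cls[OF r(1,2)] translation_mem_iff by simp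
    then show "s \<in> occupied_classes Z m ?Y"
      using r s unfolding occupied_classes_def by simp
  qed
  moreover have "inj_on ?f (occupied_classes Z m X)"
    using shift unfolding occupied_classes_def by (intro inj_onI) auto
  ultimately show ?thesis by (simp add: card_image)
qed

lemma translation_invariant_buck_density: "translation_invariant_on UNIV (buck_density Z)"
  unfolding translation_invariant_on_def buck_density_def
  by (simp add: card_occupied_classes_translation)

end

section \<open>Weighted densities\<close>

text \<open>
  The weight is compared only at sets of positive density: where the density is 0, the product is 0
  whatever the weight. This permits weights that are meaningless on negligible sets.
\<close>

lemma weighted_density:
  fixes \<mu> w :: "int set \<Rightarrow> real"
  assumes sub: "subadditive_on UNIV \<mu>" and hom: "neg_one_homogeneous_on UNIV \<mu>"
    and inv: "translation_invariant_on UNIV \<mu>" and nonneg: "\<And>X. 0 \<le> \<mu> X"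
    and w_nonneg: "\<And>X. 0 \<le> w X"
    and w_antimono: "\<And>X Y. X \<subseteq> Y \<Longrightarrow> 0 < \<mu> X \<Longrightarrow> w Y \<le> w X"
    and w_dilation: "\<And>X (k::nat). 1 \<le> k \<Longrightarrow> w (affine_image (int k) 0 X) = w X"
    and w_translation: "\<And>X (h::nat). w (affine_image 1 (int h) X) = w X"
  shows "subadditive_on H (\<lambda>X. w X * \<mu> X) \<and> neg_one_homogeneous_on H (\<lambda>X. w X * \<mu> X) \<and>
         translation_invariant_on H (\<lambda>X. w X * \<mu> X)"
proof (intro conjI)
  have le: "w Y * \<mu> X \<le> w X * \<mu> X" if "X \<subseteq> Y" for X Y
    using w_antimono[OF that] nonneg[of X]
    by (cases "\<mu> X = 0") (auto intro: mult_right_mono)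
  have "w (X \<union> Y) * \<mu> (X \<union> Y) \<le> w X * \<mu> X + w Y * \<mu> Y" for X Y
  proof -
    have "\<mu> (X \<union> Y) \<le> \<mu> X + \<mu> Y"
      using sub unfolding subadditive_on_def by blast
    then have "w (X \<union> Y) * \<mu> (X \<union> Y) \<le> w (X \<union> Y) * (\<mu> X + \<mu> Y)"
      using w_nonneg by (rule mult_left_mono)
    also have "\<dots> \<le> w X * \<mu> X + w Y * \<mu> Y"
      unfolding distrib_left by (intro add_mono le) auto
    finally show ?thesis .
  qed
  then show "subadditive_on H (\<lambda>X. w X * \<mu> X)" unfolding subadditive_on_def by blast
  show "neg_one_homogeneous_on H (\<lambda>X. w X * \<mu> X)"
    using hom w_dilation unfolding neg_one_homogeneous_on_def by simp
  show "translation_invariant_on H (\<lambda>X. w X * \<mu> X)"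
    using inv w_translation unfolding translation_invariant_on_def by simp
qed

section \<open>Ideals of sets almost disjoint from the affine images of a set\<close>

text \<open>
  The affine images of \<open>B\<close> are taken with rational ratio \<open>p / q\<close>. Integer ratios would not do: from
  \<open>k \<cdot> X\<close> belonging to the ideal it must follow that \<open>X\<close> does, and conversely, so the family of
  images has to be stable under multiplication and division by \<open>k\<close>.
\<close>

definition affinely_almost_disjoint :: "int set \<Rightarrow> int set set" where
  "affinely_almost_disjoint B =
     {X. \<forall>q>0. \<forall>p>0. \<forall>b. finite {x \<in> X. q * x + b \<in> affine_image p 0 B}}"

lemma affine_ideal_affinely_almost_disjoint: "affine_ideal (affinely_almost_disjoint B)"
proof unfold_locales
  show "{} \<in> affinely_almost_disjoint B"
    unfolding affinely_almost_disjoint_def by simp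
  show "X \<in> affinely_almost_disjoint B" if "Y \<in> affinely_almost_disjoint B" "X \<subseteq> Y" for X Y
  proof -
    have "finite {x \<in> X. P x}" if "finite {x \<in> Y. P x}" for P
      by (rule finite_subset[OF _ that]) (use \<open>X \<subseteq> Y\<close> in blast)
    then show ?thesis
      using that(1) unfolding affinely_almost_disjoint_def mem_Collect_eq by meson
  qed
  show "X \<union> Y \<in> affinely_almost_disjoint B"
    if "X \<in> affinely_almost_disjoint B" "Y \<in> affinely_almost_disjoint B" for X Y
  proof -
    have "{x \<in> X \<union> Y. P x} = {x \<in> X. P x} \<union> {x \<in> Y. P x}" for P by blast
    then show ?thesis
      using that unfolding affinely_almost_disjoint_def by simp
  qed
  show "affine_image (int k) 0 X \<in> affinely_almost_disjoint B \<longleftrightarrow> X \<in> affinely_almost_disjoint B"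
    if k: "1 \<le> k" for X and k :: nat
  proof
    assume *: "affine_image (int k) 0 X \<in> affinely_almost_disjoint B"
    \<comment> \<open>Multiply the equation \<open>q * x + b = p * z\<close> by \<open>k\<close>.\<close>
    have "finite {x \<in> X. q * x + b \<in> affine_image p 0 B}" if "0 < q" "0 < p" for q p b
    proof (rule finite_imageD)
      have "(\<lambda>x. int k * x) ` {x \<in> X. q * x + b \<in> affine_image p 0 B}
          \<subseteq> {y \<in> affine_image (int k) 0 X. q * y + int k * b \<in> affine_image (int k * p) 0 B}"
      proof
        fix y assume "y \<in> (\<lambda>x. int k * x) ` {x \<in> X. q * x + b \<in> affine_image p 0 B}"
        then obtain x z where x: "x \<in> X" "y = int k * x" and z: "z \<in> B" "q * x + b = p * z"
          unfolding affine_image_def by auto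
        have "q * y + int k * b = int k * (q * x + b)" using x by (simp add: algebra_simps)
        also have "\<dots> = int k * p * z" using z by simp
        finally show "y \<in> {y \<in> affine_image (int k) 0 X.
            q * y + int k * b \<in> affine_image (int k * p) 0 B}"
          using x z unfolding affine_image_def by auto
      qed
      moreover have "finite {y \<in> affine_image (int k) 0 X.
          q * y + int k * b \<in> affine_image (int k * p) 0 B}"
        using * that k unfolding affinely_almost_disjoint_def by simp
      ultimately show "finite ((\<lambda>x. int k * x) ` {x \<in> X. q * x + b \<in> affine_image p 0 B})"
        by (rule finite_subset)
      show "inj_on (\<lambda>x. int k * x) {x \<in> X. q * x + b \<in> affine_image p 0 B}"
        using k by (intro inj_onI) simp
    qed
    then show "X \<in> affinely_almost_disjoint B" unfolding affinely_almost_disjoint_def by simp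
  next
    assume *: "X \<in> affinely_almost_disjoint B"
    have "finite {y \<in> affine_image (int k) 0 X. q * y + b \<in> affine_image p 0 B}"
      if "0 < q" "0 < p" for q p b
    proof -
      have "{y \<in> affine_image (int k) 0 X. q * y + b \<in> affine_image p 0 B}
          \<subseteq> (\<lambda>x. int k * x) ` {x \<in> X. (q * int k) * x + b \<in> affine_image p 0 B}"
        by (auto simp: affine_image_def[of "int k"] mult.assoc)
      moreover have "finite {x \<in> X. (q * int k) * x + b \<in> affine_image p 0 B}"
        using * that k unfolding affinely_almost_disjoint_def by simp
      ultimately show ?thesis using finite_subset by blast
    qed
    then show "affine_image (int k) 0 X \<in> affinely_almost_disjoint B"
      unfolding affinely_almost_disjoint_def by simp
  qed
  show "affine_image 1 (int h) X \<in> affinely_almost_disjoint B \<longleftrightarrow> X \<in> affinely_almost_disjoint B"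
    for X and h :: nat
  proof -
    have eq: "{y \<in> affine_image 1 (int h) X. q * y + b \<in> affine_image p 0 B}
        = (\<lambda>x. x + int h) ` {x \<in> X. q * x + (q * int h + b) \<in> affine_image p 0 B}" for q p b
      by (auto simp: affine_image_def[of 1] algebra_simps)
    have fin: "finite {y \<in> affine_image 1 (int h) X. q * y + b \<in> affine_image p 0 B}
        \<longleftrightarrow> finite {x \<in> X. q * x + (q * int h + b) \<in> affine_image p 0 B}" for q p b
      unfolding eq by (intro finite_image_iff inj_onI) simp
    have all_shift: "(\<forall>b. P (q * int h + b)) \<longleftrightarrow> (\<forall>b. P b)" for P :: "int \<Rightarrow> bool" and q
    proof
      assume *: "\<forall>b. P (q * int h + b)"
      show "\<forall>b. P b"
      proof
        fix b show "P b" using *[rule_format, of "b - q * int h"] by simp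
      qed
    qed simp
    have "(\<forall>b. finite {x \<in> X. q * x + (q * int h + b) \<in> affine_image p 0 B})
        \<longleftrightarrow> (\<forall>b. finite {x \<in> X. q * x + b \<in> affine_image p 0 B})" for q p
      by (rule all_shift)
    then show ?thesis
      unfolding affinely_almost_disjoint_def mem_Collect_eq fin by simp
  qed
qed

section \<open>Sparse sets meeting every residue class\<close>

text \<open>
  The index \<open>i\<close> encodes a triple \<open>(n, r, t)\<close>. The factorial makes the gaps grow and is divisible by any
  given modulus once \<open>i\<close> is large, so that the added \<open>r\<close> decides the residue class. The number \<open>n\<close> says
  to which set the point belongs, and \<open>t\<close> only serves to repeat every pair \<open>(n, r)\<close> infinitely often.
\<close>

definition spike :: "nat \<Rightarrow> int" where
  "spike i = fact i + int (fst (prod_decode (snd (prod_decode i))))"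

definition spikes :: "nat \<Rightarrow> int set" where
  "spikes n = spike ` {i. fst (prod_decode i) = n}"

lemma spike_lower: "fact i \<le> spike i"
  unfolding spike_def by simp

lemma spike_upper: "spike i \<le> 2 * fact i"
proof -
  obtain n r t where i: "i = prod_encode (n, prod_encode (r, t))"
    by (metis prod_decode_inverse surj_pair)
  have "r \<le> i"
    unfolding i using le_prod_encode_1 le_prod_encode_2 order_trans by blast
  also have "i \<le> fact i" by (rule fact_ge_self)
  finally have "int r \<le> fact i" by (metis of_nat_fact of_nat_le_iff)
  then show ?thesis unfolding spike_def i by simp
qed

lemma spikes_pos: "spikes n \<subseteq> {1..}"
  using spike_lower order_trans[OF fact_ge_1] unfolding spikes_def by fastforce

text \<open>
  Since \<open>j!\<close> is at least \<open>(i + 1) i!\<close> for \<open>j > i\<close>, an affine function can carry the \<open>i\<close>-th point up to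
  a later one only if \<open>i\<close> is small compared with its coefficients.
\<close>

lemma spike_gap:
  assumes "i < j" "0 < q" "spike j \<le> q * spike i + b"
  shows "i < nat (2 * q + \<bar>b\<bar>)"
proof -
  have "int (Suc i) * fact i = fact (Suc i)" by (simp add: algebra_simps)
  also have "\<dots> \<le> fact j" using assms by (intro fact_mono) simp
  also have "\<dots> \<le> q * spike i + b" using spike_lower assms(3) order_trans by blast
  also have "\<dots> \<le> q * (2 * fact i) + \<bar>b\<bar> * fact i"
  proof (intro add_mono mult_left_mono spike_upper)
    have "\<bar>b\<bar> * 1 \<le> \<bar>b\<bar> * fact i" by (intro mult_left_mono fact_ge_1) simp
    then show "b \<le> \<bar>b\<bar> * fact i" by simp
  qed (use assms in simp)
  also have "\<dots> = (2 * q + \<bar>b\<bar>) * fact i" by (simp add: algebra_simps)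
  finally have "int (Suc i) \<le> 2 * q + \<bar>b\<bar>"
    by (simp add: mult_le_cancel_right del: of_nat_Suc)
  then show ?thesis by linarith
qed

text \<open>
  A common point of two affine images yields \<open>q * spike i + b = p * spike j\<close>, with \<open>i \<noteq> j\<close> because the
  two sets use different indices. The gap estimate, used in the direction from the smaller index to
  the larger one, bounds the smaller index, and either index determines the point.
\<close>

lemma spikes_almost_disjoint:
  assumes "m \<noteq> n"
  shows "spikes m \<in> affinely_almost_disjoint (spikes n)"
  unfolding affinely_almost_disjoint_def
proof (clarify)
  fix q p b :: int assume q: "0 < q" and p: "0 < p"
  let ?C = "nat (2 * q + \<bar>b\<bar>)" and ?D = "nat (2 * p + \<bar>b\<bar>)"
  have "{x \<in> spikes m. q * x + b \<in> affine_image p 0 (spikes n)}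
      \<subseteq> spike ` {..<?C} \<union> (\<lambda>j. (p * spike j - b) div q) ` {..<?D}"
  proof
    fix x assume "x \<in> {x \<in> spikes m. q * x + b \<in> affine_image p 0 (spikes n)}"
    then obtain i j where i: "x = spike i" "fst (prod_decode i) = m"
      and j: "fst (prod_decode j) = n" and eq: "q * spike i + b = p * spike j"
      unfolding spikes_def affine_image_def by auto
    have pos: "0 < spike l" for l using spike_lower fact_gt_zero less_le_trans by blast
    have "i \<noteq> j" using i j assms by auto
    then consider "i < j" | "j < i" by linarith
    then show "x \<in> spike ` {..<?C} \<union> (\<lambda>j. (p * spike j - b) div q) ` {..<?D}"
    proof cases
      case 1
      have "spike j \<le> q * spike i + b" using eq p pos[of j] by simp
      from spike_gap[OF 1 q this] show ?thesis using i by blast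
    next
      case 2
      have "spike i \<le> q * spike i" using q pos[of i] by simp
      also have "\<dots> = p * spike j + - b" using eq by simp
      finally have "j < ?D" using spike_gap[OF 2 p] by fastforce
      moreover have "(p * spike j - b) div q = x"
        using q i by (simp flip: eq)
      ultimately show ?thesis by blast
    qed
  qed
  then show "finite {x \<in> spikes m. q * x + b \<in> affine_image p 0 (spikes n)}"
    by (rule finite_subset) simp
qed

lemma infinite_spikes_mod:
  assumes "0 \<le> r" "r < int m"
  shows "infinite {x \<in> spikes n. x mod int m = r}"
proof
  let ?S = "{x \<in> spikes n. x mod int m = r}"
  assume "finite ?S"
  then have M: "x \<le> Max ?S" if "x \<in> spikes n" "x mod int m = r" for x
    using that by (intro Max_ge) auto
  \<comment> \<open>The repetition number makes the index exceed both the modulus and the supposed maximum.\<close>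
  define t where "t = max m (nat (Max ?S + 1))"
  define i where "i = prod_encode (n, prod_encode (nat r, t))"
  have "t \<le> i" unfolding i_def using le_prod_encode_2[of t] le_prod_encode_2 le_trans by blast
  then have "m dvd fact i" using assms unfolding t_def by (intro dvd_fact) auto
  then have "int m dvd fact i" by (metis of_nat_dvd_iff of_nat_fact)
  moreover have "spike i = fact i + r" using assms unfolding spike_def by (simp add: i_def)
  ultimately have "spike i mod int m = r"
    using assms by (simp add: mod_add_eq[symmetric, of "fact i"] dvd_eq_mod_eq_0)
  moreover have "spike i \<in> spikes n"
    unfolding spikes_def by (intro imageI) (simp add: i_def)
  ultimately have "spike i \<le> Max ?S" by (rule M[rotated])
  moreover have "int i \<le> spike i"
    using fact_ge_self[of i] spike_lower[of i] by (smt (verit) of_nat_fact of_nat_le_iff)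
  ultimately show False using \<open>t \<le> i\<close> by (auto simp: t_def)
qed

lemma spikes_mod_not_almost_disjoint:
  assumes "spikes n \<subseteq> X" "0 \<le> r" "r < int m"
  shows "{x \<in> X. x mod int m = r} \<notin> affinely_almost_disjoint (spikes n)"
proof
  assume "{x \<in> X. x mod int m = r} \<in> affinely_almost_disjoint (spikes n)"
  then have "finite {x \<in> {x \<in> X. x mod int m = r}. 1 * x + 0 \<in> affine_image 1 0 (spikes n)}"
    unfolding affinely_almost_disjoint_def mem_Collect_eq by (metis zero_less_one)
  then have "finite {x \<in> spikes n. x mod int m = r}"
    by (rule rev_finite_subset) (use assms in \<open>auto simp: affine_image_def\<close>)
  with infinite_spikes_mod[OF assms(2,3)] show False by simp
qed

section \<open>Non-monotone weighted Buck densities\<close>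

abbreviation spike_ideal :: "nat \<Rightarrow> int set set" where
  "spike_ideal n \<equiv> affinely_almost_disjoint (spikes n)"

abbreviation core_ideal :: "int set set" where
  "core_ideal \<equiv> \<Inter>n. spike_ideal n"

interpretation spike: affine_ideal "spike_ideal n" for n
  by (rule affine_ideal_affinely_almost_disjoint)

interpretation core: affine_ideal core_ideal
  by (rule affine_ideal_Inter) (rule affine_ideal_affinely_almost_disjoint)

lemma buck_density_spike_ideal_eq_1:
  assumes "spikes n \<subseteq> X"
  shows "buck_density (spike_ideal n) X = 1"
  by (rule buck_density_eq_1) (rule spikes_mod_not_almost_disjoint[OF assms])

lemma buck_density_core_ideal_eq_1:
  assumes "spikes n \<subseteq> X"
  shows "buck_density core_ideal X = 1"
  by (rule buck_density_eq_1) (use spikes_mod_not_almost_disjoint[OF assms] in blast)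

lemma spikes_notin_spike_ideal:
  assumes "spikes n \<subseteq> X"
  shows "X \<notin> spike_ideal n"
  using spike.buck_density_eq_0 buck_density_spike_ideal_eq_1[OF assms] by fastforce

text \<open>
  \<open>spikes n\<close> lies in every \<open>spike_ideal m\<close> with \<open>m < n\<close> but not in \<open>spike_ideal n\<close>, so the
  index of the first ideal missing a given set takes every value \<open>n\<close>, on sets of density 1 modulo
  \<open>core_ideal\<close>. Used as a weight, it makes the density unbounded.
\<close>

lemma exists_unbounded:
  assumes H: "{1..} \<subseteq> H"
  shows "\<exists>\<theta>. \<not> mono_on (Pow H) \<theta> \<and> subadditive_on H \<theta> \<and> neg_one_homogeneous_on H \<theta> \<and>
             translation_invariant_on H \<theta> \<and> (SUP X\<in>Pow H. ereal (\<theta> X)) = \<infinity>"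
proof -
  let ?\<mu> = "buck_density core_ideal"
  define rank where "rank X = (LEAST n. X \<notin> spike_ideal n)" for X
  define \<theta> where "\<theta> X = (1 + real (rank X)) * ?\<mu> X" for X
  have spikes_H: "spikes n \<subseteq> H" for n
    using spikes_pos H by (rule subset_trans)
  \<comment> \<open>On members of \<open>core_ideal\<close> the \<open>LEAST\<close> is unspecified, hence the condition of positivity.\<close>
  have rank_le: "rank Y \<le> rank X" if "X \<subseteq> Y" "0 < ?\<mu> X" for X Y
  proof -
    have "X \<notin> core_ideal" using that core.buck_density_eq_0 by fastforce
    then have "X \<notin> spike_ideal (rank X)" unfolding rank_def by (metis (mono_tags, lifting) INT_I LeastI)
    then have "Y \<notin> spike_ideal (rank X)" using spike.subset_mem[OF _ that(1)] by metis
    then show ?thesis unfolding rank_def[of Y] by (rule Least_le)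
  qed
  have rank_dilation: "rank (affine_image (int k) 0 X) = rank X" if "1 \<le> k" for X and k :: nat
    unfolding rank_def using that by (simp add: spike.dilation_mem_iff)
  have rank_translation: "rank (affine_image 1 (int h) X) = rank X" for X and h :: nat
    unfolding rank_def by (simp add: spike.translation_mem_iff)
  have ax: "subadditive_on H \<theta> \<and> neg_one_homogeneous_on H \<theta> \<and> translation_invariant_on H \<theta>"
    unfolding \<theta>_def
    by (rule weighted_density) (auto intro: core.subadditive_buck_density
        core.homogeneous_buck_density core.translation_invariant_buck_density
        buck_density_nonneg rank_le simp: rank_dilation rank_translation)
  have rank_spikes: "rank (spikes n) = n" for n
    unfolding rank_def
  proof (rule Least_equality)
    show "spikes n \<notin> spike_ideal n" by (rule spikes_notin_spike_ideal) simp
    show "n \<le> m" if "spikes n \<notin> spike_ideal m" for m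
      using that spikes_almost_disjoint[of n m] by (cases "n = m") auto
  qed
  have \<theta>_spikes: "\<theta> (spikes n) = 1 + real n" for n
    unfolding \<theta>_def rank_spikes by (simp add: buck_density_core_ideal_eq_1[OF order_refl])
  have "rank H = 0"
    unfolding rank_def using spikes_notin_spike_ideal[OF spikes_H] by simp
  then have "\<theta> H = 1"
    unfolding \<theta>_def by (simp add: buck_density_core_ideal_eq_1[OF spikes_H])
  then have "\<not> \<theta> (spikes 1) \<le> \<theta> H" by (simp add: \<theta>_spikes)
  then have "\<not> mono_on (Pow H) \<theta>"
    using spikes_H[of 1] unfolding mono_on_def by blast
  moreover have "(SUP X\<in>Pow H. ereal (\<theta> X)) = \<infinity>"
  proof (rule SUP_PInfty)
    fix n show "\<exists>X\<in>Pow H. ereal (real n) \<le> ereal (\<theta> X)"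
      using spikes_H[of n] by (intro bexI[of _ "spikes n"]) (auto simp: \<theta>_spikes)
  qed
  ultimately show ?thesis using ax by blast
qed

text \<open>
  Two densities are needed because a weight above 1 must not act on a set of density 1. In the mean
  of two densities, a set that is negligible for one of them has value at most 1/2, which leaves
  room for the weight 2.
\<close>

lemma exists_nonmonotone_quasi_density:
  assumes H: "{1..} \<subseteq> H"
  shows "\<exists>\<mu>. upper_quasi_density H \<mu> \<and> \<not> mono_on (Pow H) \<mu>"
proof -
  let ?\<kappa> = "buck_density core_ideal" and ?\<sigma> = "buck_density (spike_ideal 0)"
  define w where "w X = (if X \<in> spike_ideal 0 then 2 else 1 :: real)" for X
  define \<mu> where "\<mu> X = (?\<kappa> X + ?\<sigma> X) / 2" for X
  define \<theta> where "\<theta> X = w X * \<mu> X" for X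
  have spikes_H: "spikes n \<subseteq> H" for n
    using spikes_pos H by (rule subset_trans)
  have sub: "subadditive_on UNIV \<mu>"
    unfolding subadditive_on_def
  proof (intro allI impI)
    fix X Y
    have "?\<kappa> (X \<union> Y) \<le> ?\<kappa> X + ?\<kappa> Y" "?\<sigma> (X \<union> Y) \<le> ?\<sigma> X + ?\<sigma> Y"
      using core.subadditive_buck_density spike.subadditive_buck_density[of 0]
      unfolding subadditive_on_def by simp_all
    then show "\<mu> (X \<union> Y) \<le> \<mu> X + \<mu> Y" unfolding \<mu>_def by (simp add: field_simps)
  qed
  have hom: "neg_one_homogeneous_on UNIV \<mu>"
    using core.homogeneous_buck_density spike.homogeneous_buck_density[of 0]
    unfolding neg_one_homogeneous_on_def \<mu>_def by (simp add: add_divide_distrib)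
  have inv: "translation_invariant_on UNIV \<mu>"
    using core.translation_invariant_buck_density spike.translation_invariant_buck_density[of 0]
    unfolding translation_invariant_on_def \<mu>_def by simp
  have w_anti: "w Y \<le> w X" if "X \<subseteq> Y" for X Y
    using spike.subset_mem[OF _ that] unfolding w_def by auto
  have ax: "subadditive_on H \<theta> \<and> neg_one_homogeneous_on H \<theta> \<and> translation_invariant_on H \<theta>"
    unfolding \<theta>_def
    by (rule weighted_density[OF sub hom inv]) (auto simp: \<mu>_def buck_density_nonneg w_anti
        w_def spike.dilation_mem_iff spike.translation_mem_iff dest: spike.subset_mem)
  have ideal: "\<theta> X = ?\<kappa> X" if "X \<in> spike_ideal 0" for X
    using that spike.buck_density_eq_0 unfolding \<theta>_def w_def \<mu>_def by simp
  have other: "\<theta> X = (?\<kappa> X + ?\<sigma> X) / 2" if "X \<notin> spike_ideal 0" for X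
    using that unfolding \<theta>_def w_def \<mu>_def by simp
  have le_1: "\<theta> X \<le> 1" for X
    using buck_density_le_1[of core_ideal X] buck_density_le_1[of "spike_ideal 0" X]
    by (cases "X \<in> spike_ideal 0") (simp_all add: ideal other)
  have \<theta>_H: "\<theta> H = 1"
    using other[OF spikes_notin_spike_ideal[OF spikes_H]]
    by (simp add: buck_density_core_ideal_eq_1[OF spikes_H] buck_density_spike_ideal_eq_1[OF spikes_H])
  have "\<not> mono_on (Pow H) \<theta>"
  proof
    assume mono: "mono_on (Pow H) \<theta>"
    \<comment> \<open>\<open>spikes 1\<close> owes its value to the weight 2. Adding \<open>?D\<close> takes it out of \<open>spike_ideal 0\<close>,
      so the weight drops to 1, while the density modulo \<open>spike_ideal 0\<close> rises only to 1/2.\<close>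
    let ?D = "affine_image (int 2) 0 (spikes 0)"
    let ?Y = "spikes 1 \<union> ?D"
    have D: "?D \<subseteq> H" using spikes_pos[of 0] H unfolding affine_image_def by fastforce
    have spikes1: "spikes 1 \<in> spike_ideal 0" by (rule spikes_almost_disjoint) simp
    then have \<theta>_spikes: "\<theta> (spikes 1) = 1"
      by (simp add: ideal buck_density_core_ideal_eq_1[OF order_refl])
    have "?\<sigma> ?D = 1 / real 2 * ?\<sigma> (spikes 0)"
      using spike.homogeneous_buck_density[of 0, unfolded neg_one_homogeneous_on_def,
          rule_format, of "spikes 0" 2] by simp
    then have "?\<sigma> ?D = 1 / 2" by (simp add: buck_density_spike_ideal_eq_1)
    moreover have "?\<sigma> ?Y \<le> ?\<sigma> (spikes 1) + ?\<sigma> ?D"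
      using spike.subadditive_buck_density[of 0] unfolding subadditive_on_def by simp
    ultimately have half: "?\<sigma> ?Y \<le> 1 / 2"
      using spike.buck_density_eq_0[OF spikes1] by simp
    have "?D \<notin> spike_ideal 0"
      using spike.dilation_mem_iff[of 2 "spikes 0" 0] spikes_notin_spike_ideal[of 0 "spikes 0"] by simp
    then have "?Y \<notin> spike_ideal 0" using spike.subset_mem[of ?Y 0 ?D] by auto
    then have "\<theta> ?Y \<le> 3 / 4"
      using half buck_density_le_1[of core_ideal ?Y] by (simp add: other)
    moreover have "\<theta> (spikes 1) \<le> \<theta> ?Y"
      using mono spikes_H[of 1] D by (auto simp: mono_on_def)
    ultimately show False using \<theta>_spikes by simp
  qed
  then show ?thesis
    using ax le_1 \<theta>_H unfolding upper_quasi_density_def by blast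
qed

lemma exists_bounded:
  fixes c :: real
  assumes H: "{1..} \<subseteq> H" and c: "0 < c"
  shows "\<exists>\<theta>. \<not> mono_on (Pow H) \<theta> \<and> subadditive_on H \<theta> \<and> neg_one_homogeneous_on H \<theta> \<and>
             translation_invariant_on H \<theta> \<and> (SUP X\<in>Pow H. ereal (\<theta> X)) = ereal c"
proof -
  obtain \<mu> where \<mu>: "upper_quasi_density H \<mu>" and nonmono: "\<not> mono_on (Pow H) \<mu>"
    using exists_nonmonotone_quasi_density[OF H] by blast
  have "\<not> mono_on (Pow H) (\<lambda>X. c * \<mu> X)"
    using nonmono c unfolding mono_on_def by simp
  moreover have "subadditive_on H (\<lambda>X. c * \<mu> X)"
    using \<mu> c unfolding upper_quasi_density_def subadditive_on_def
    by (simp flip: distrib_left)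
  moreover have "neg_one_homogeneous_on H (\<lambda>X. c * \<mu> X)" "translation_invariant_on H (\<lambda>X. c * \<mu> X)"
    using \<mu> unfolding upper_quasi_density_def neg_one_homogeneous_on_def translation_invariant_on_def
    by simp_all
  moreover have "(SUP X\<in>Pow H. ereal (c * \<mu> X)) = ereal c"
  proof (rule antisym)
    show "(SUP X\<in>Pow H. ereal (c * \<mu> X)) \<le> ereal c"
      using \<mu> c unfolding upper_quasi_density_def by (intro SUP_least) simp
    show "ereal c \<le> (SUP X\<in>Pow H. ereal (c * \<mu> X))"
      using \<mu> unfolding upper_quasi_density_def by (intro SUP_upper2[of H]) auto
  qed
  ultimately show ?thesis by blast
qed

theorem theorem1:
  fixes H :: "int set"
  assumes "H = UNIV \<or> H = {0..} \<or> H = {1..}"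
  shows "(\<forall>K::ereal. 1 \<le> K \<longrightarrow>
            (\<exists>\<theta> :: int set \<Rightarrow> real.
               \<not> mono_on (Pow H) \<theta> \<and> subadditive_on H \<theta> \<and>
               neg_one_homogeneous_on H \<theta> \<and> translation_invariant_on H \<theta> \<and>
               (SUP X\<in>Pow H. ereal (\<theta> X)) = K))
       \<and> (\<exists>\<mu> :: int set \<Rightarrow> real. upper_quasi_density H \<mu> \<and> \<not> upper_density H \<mu>)"
proof (intro conjI allI impI)
  have H: "{1..} \<subseteq> H" using assms by auto
  fix K :: ereal assume "1 \<le> K"
  then consider c where "K = ereal c" "0 < c" | "K = \<infinity>"
    by (cases K) auto
  then show "\<exists>\<theta>. \<not> mono_on (Pow H) \<theta> \<and> subadditive_on H \<theta> \<and> neg_one_homogeneous_on H \<theta> \<and>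
               translation_invariant_on H \<theta> \<and> (SUP X\<in>Pow H. ereal (\<theta> X)) = K"
    by cases (use exists_bounded[OF H] exists_unbounded[OF H] in auto)
next
  have "{1..} \<subseteq> H" using assms by auto
  from exists_nonmonotone_quasi_density[OF this]
  show "\<exists>\<mu>. upper_quasi_density H \<mu> \<and> \<not> upper_density H \<mu>"
    unfolding upper_density_def by blast
qed

end
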